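(* For every $M>0$ and every $m\in\mathbb{N}$ there is a constant $C(m,M)>0$, depending only on $m$ and $M$, such that for every integer $n\ge 2$ with $n\ge m$ and every polynomial $P_n(z)=\sum_{k=0}^n a_{k,n}z^k\in\mathbb{Z}_n^s(D,M)$, $$|a_{n-m,n}|\le C(m,M)\,(n\log n)^{m/2}.$$
   Context: $\mathbb{N}$ is the set of positive integers. $D:=\{z\in\mathbb{C}:|z|\le 1\}$ is the closed unit disk. $\mathbb{Z}_n^s(D,M)$ denotes the set of polynomials with integer coefficients, of exact degree $n$, all of whose zeros are simple and lie in $D$, and whose leading coefficient $a_{n,n}$ satisfies $|a_{n,n}|\le M$. $\log$ is the natural logarithm. *)

theory Defs
  imports "HOL-Analysis.Analysis" "HOL-Computational_Algebra.Polynomial"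
begin

(* \<int>_n^s(E, M).  The integer polynomial is mapped into the complex polynomials only to
   speak about its zeros; a zero z is simple if its multiplicity, order z, is 1.
   The zero polynomial, which the library gives degree 0, does not belong to the set for
   n = 0 and E the unit disk, since each complex number is one of its roots. *)
definition int_polys_simple_zeros :: "nat \<Rightarrow> complex set \<Rightarrow> real \<Rightarrow> int poly set" where
  "int_polys_simple_zeros n E M =
    {p. degree p = n \<and>
        (\<forall>z. poly (map_poly of_int p) z = 0 \<longrightarrow>
              z \<in> E \<and> order z (map_poly of_int p) = 1) \<and>
        \<bar>real_of_int (lead_coeff p)\<bar> \<le> M}"

end

theory Submission
  imports Defs "Subresultants.Resultant_Prelim"
    "HOL-Computational_Algebra.Fundamental_Theorem_Algebra"
begin

text \<open>
  Let \<open>z\<^sub>1, \<dots>, z\<^sub>n\<close> be the zeros and \<open>a\<close> the leading coefficient of the polynomial, and let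
  \<open>s\<^sub>k\<close> be the sum of the \<open>k\<close>-th powers of the zeros. The theorem follows from
  \<open>|s\<^sub>k| \<le> c sqrt (n ln n)\<close> for \<open>1 \<le> k \<le> m\<close>: Newton's identities write \<open>a\<^sub>n\<^sub>-\<^sub>m\<close> as a polynomial
  in \<open>a, s\<^sub>1, \<dots>, s\<^sub>m\<close> that is isobaric of weight \<open>m\<close>, so that each of its terms has at most
  \<open>m\<close> power sums as factors.

  The bound for \<open>s\<^sub>k\<close> expresses that the zeros are nearly equidistributed in angle, and it
  comes from comparing two estimates for a logarithmic energy. On the one hand, the resultant of
  the polynomial and its derivative is an integer, and it is nonzero because the zeros are simple;
  hence \<open>|a|\<^sup>2\<^sup>n\<^sup>-\<^sup>1 \<Prod>\<^sub>i\<^sub>\<noteq>\<^sub>j |z\<^sub>i - z\<^sub>j| \<ge> 1\<close> (\<open>int_poly_root_separation\<close>), which says that the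
  zeros cannot cluster. On the other hand, for \<open>0 < r < 1\<close> the power series of the logarithm gives
  \<open>\<Sum>\<^sub>i\<^sub>,\<^sub>j - ln |1 - r z\<^sub>i cnj z\<^sub>j| = \<Sum>\<^sub>k r\<^sup>k |s\<^sub>k|\<^sup>2 / k\<close> (\<open>power_sum_energy\<close>), and each term on the
  right is nonnegative, so that each of them is bounded by the left side. In the unit disk
  \<open>|1 - r z cnj w| \<ge> sqrt r |z - w|\<close>, so the terms with \<open>i \<noteq> j\<close> contribute at most
  \<open>n\<^sup>2 ln (1/r) / 2 + 2 n ln |a|\<close>; the diagonal contributes at most \<open>n ln (1/(1 - r))\<close>. The choice
  \<open>r = 1 - 1/n\<close> makes the total of order \<open>n ln n\<close>.
\<close>

section \<open>The resultant as a product over roots\<close>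

lemma poly_eq_sum_descending:
  fixes p :: "'a::comm_semiring_1 poly"
  assumes "degree p < N"
  shows "poly p x = (\<Sum>j<N. coeff p (N - Suc j) * x ^ (N - Suc j))"
proof -
  have "poly p x = (\<Sum>i<N. coeff p i * x ^ i)"
    unfolding poly_altdef using assms
    by (intro sum.mono_neutral_left) (auto simp: coeff_eq_0)
  also have "\<dots> = (\<Sum>j<N. coeff p (N - Suc j) * x ^ (N - Suc j))"
    by (rule sum.nat_diff_reindex[symmetric])
  finally show ?thesis .
qed

text \<open>
  A vector in the kernel of the transpose lists the coefficients of a polynomial of degree less
  than \<open>m\<close> that vanishes at the \<open>m\<close> distinct points \<open>x k\<close>.
\<close>
lemma det_vandermonde_nonzero:
  fixes x :: "nat \<Rightarrow> 'a::field"
  assumes "inj_on x {..<m}"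
  shows "Determinant.det (Matrix.mat m m (\<lambda>(i, k). x k ^ (m - Suc i))) \<noteq> 0"
    (is "Determinant.det ?V \<noteq> 0")
proof
  assume det0: "Determinant.det ?V = 0"
  have carr: "transpose_mat ?V \<in> carrier_mat m m" by simp
  have "Determinant.det (transpose_mat ?V) = 0"
    using det0 by (subst Determinant.det_transpose[of _ m]) auto
  then obtain v where v: "v \<in> carrier_vec m" "v \<noteq> 0\<^sub>v m"
    and ker: "transpose_mat ?V *\<^sub>v v = 0\<^sub>v m"
    using det_0_iff_vec_prod_zero[OF carr] by blast
  define p where "p = (\<Sum>i<m. monom (vec_index v i) (m - Suc i))"
  have root: "poly p (x k) = 0" if "k < m" for k
  proof -
    have "0 = vec_index (transpose_mat ?V *\<^sub>v v) k"
      using ker that by simp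
    also have "\<dots> = (\<Sum>i<m. x k ^ (m - Suc i) * vec_index v i)"
      using that v(1) by (auto simp: scalar_prod_def atLeast0LessThan intro!: sum.cong)
    also have "\<dots> = poly p (x k)"
      by (simp add: p_def poly_sum poly_monom mult.commute)
    finally show ?thesis by simp
  qed
  have coeff_p: "coeff p (m - Suc i) = vec_index v i" if "i < m" for i
  proof -
    have "coeff p (m - Suc i) = (\<Sum>j<m. if j = i then vec_index v j else 0)"
      unfolding p_def coeff_sum using that by (intro sum.cong) auto
    then show ?thesis using that by simp
  qed
  have "p \<noteq> 0"
  proof
    assume "p = 0"
    then have "vec_index v i = 0" if "i < m" for i using coeff_p[OF that] by simp
    then have "v = 0\<^sub>v m" using v(1) by (intro eq_vecI) auto
    with v(2) show False by simp
  qed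
  have "m > 0" using v by (cases m) auto
  have "degree p < m"
  proof -
    have "degree p \<le> m - 1" unfolding p_def
      by (intro degree_sum_le) (auto intro: order.trans[OF degree_monom_le])
    with \<open>m > 0\<close> show ?thesis by simp
  qed
  moreover have "m = card (x ` {..<m})" using assms by (simp add: card_image)
  moreover have "card (x ` {..<m}) \<le> card {z. poly p z = 0}"
    using root \<open>p \<noteq> 0\<close> by (intro card_mono poly_roots_finite) auto
  moreover have "card {z. poly p z = 0} \<le> degree p"
    using \<open>p \<noteq> 0\<close> by (rule card_poly_roots_bound)
  ultimately show False by linarith
qed

text \<open>
  The rows of the Sylvester matrix \<open>S\<close> hold the coefficients, in descending order, of the multiples
  \<open>X\<^sup>i p\<close> and \<open>X\<^sup>i q\<close>. Multiplication of a row by the column of descending powers of \<open>x k\<close>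
  evaluates that multiple at \<open>x k\<close>, and the multiples of \<open>p\<close> give \<open>0\<close> there. Thus, if the
  matrix \<open>W\<close> consists of the first \<open>n\<close> unit vectors followed by these columns, \<open>S W\<close> is block
  triangular: one block is triangular with the leading coefficient of \<open>p\<close> on its diagonal, the other
  is a Vandermonde matrix with columns scaled by \<open>q (x k)\<close>. The same Vandermonde determinant is the
  determinant of \<open>W\<close>, and it cancels because the points are distinct.
\<close>
lemma resultant_eq_prod_over_roots:
  fixes p q :: "'a::field poly" and x :: "nat \<Rightarrow> 'a"
  assumes inj: "inj_on x {..<degree p}"
    and root: "\<And>k. k < degree p \<Longrightarrow> poly p (x k) = 0"
  shows "resultant p q = lead_coeff p ^ degree q * (\<Prod>k<degree p. poly q (x k))"
proof -
  define m n where "m = degree p" and "n = degree q"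
  define S where "S = sylvester_mat p q"
  define V where "V = Matrix.mat m m (\<lambda>(i, k). x k ^ (m - Suc i))"
  define W where "W = four_block_mat (1\<^sub>m n)
    (Matrix.mat n m (\<lambda>(j, k). x k ^ (m + n - Suc j))) (0\<^sub>m m n) V"
  define U where "U = Matrix.mat n n (\<lambda>(i, j). S $$ (i, j))"
  define L where "L = Matrix.mat m n (\<lambda>(i, j). S $$ (i + n, j))"
  define R where "R = four_block_mat U (0\<^sub>m n m) L (V * mat_diag m (\<lambda>k. poly q (x k)))"
  have S_carrier: "S \<in> carrier_mat (m + n) (m + n)"
    by (simp add: S_def m_def n_def sylvester_carrier_mat)
  have V_carrier: "V \<in> carrier_mat m m" by (simp add: V_def)
  have W_carrier: "W \<in> carrier_mat (m + n) (m + n)"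
    using V_carrier by (auto simp: W_def)
  have [simp]: "dim_row (mat_diag m f) = m" "dim_col (mat_diag m f) = m" for f :: "nat \<Rightarrow> 'a"
    by (simp_all add: mat_diag_def)
  have S_top: "S $$ (i, j) = coeff (monom 1 (n - Suc i) * p) (m + n - Suc j)"
    if "i < n" "j < m + n" for i j
    using that unfolding S_def m_def n_def
    by (subst sylvester_index_mat) (auto simp: coeff_monom_mult coeff_eq_0 intro!: arg_cong[of _ _ "coeff p"])
  have S_bot: "S $$ (i + n, j) = coeff (monom 1 (m - Suc i) * q) (m + n - Suc j)"
    if "i < m" "j < m + n" for i j
    using that unfolding S_def m_def n_def
    by (subst sylvester_index_mat) (auto simp: coeff_monom_mult coeff_eq_0 intro!: arg_cong[of _ _ "coeff q"])
  have W_left: "W $$ (j, k) = (if j = k then 1 else 0)" if "j < m + n" "k < n" for j k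
    using that by (auto simp: W_def V_def)
  have W_right: "W $$ (j, k + n) = x k ^ (m + n - Suc j)" if "j < m + n" "k < m" for j k
    using that by (auto simp: W_def V_def)
  have SW: "(S * W) $$ (i, k) = (\<Sum>j<m + n. S $$ (i, j) * W $$ (j, k))"
    if "i < m + n" "k < m + n" for i k
    using that S_carrier W_carrier
    by (auto simp: scalar_prod_def atLeast0LessThan intro!: sum.cong)
  have deg: "degree (monom 1 a * f) < m + n" if "a + degree f < m + n" for a and f :: "'a poly"
    using that degree_mult_le[of "monom 1 a" f] degree_monom_le[of "1::'a" a] by linarith
  have eq: "S * W = R"
  proof (rule eq_matI)
    show "dim_row (S * W) = dim_row R" "dim_col (S * W) = dim_col R"
      using S_carrier W_carrier V_carrier by (auto simp: R_def U_def)
    fix i k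
    assume "i < dim_row R" "k < dim_col R"
    then have ik: "i < m + n" "k < m + n" using V_carrier by (auto simp: R_def U_def)
    show "(S * W) $$ (i, k) = R $$ (i, k)"
    proof (cases "k < n")
      case True
      have "(S * W) $$ (i, k) = (\<Sum>j<m + n. if j = k then S $$ (i, j) else 0)"
        unfolding SW[OF ik] using True by (intro sum.cong) (auto simp: W_left)
      also have "\<dots> = S $$ (i, k)" using ik by simp
      also have "\<dots> = R $$ (i, k)"
        using ik True V_carrier by (auto simp: R_def U_def L_def)
      finally show ?thesis .
    next
      case False
      then obtain l where l: "k = l + n" "l < m"
        using ik by (metis add.commute add_less_cancel_right le_Suc_ex linorder_not_less)
      show ?thesis
      proof (cases "i < n")
        case True
        have "degree (monom 1 (n - Suc i) * p) < m + n"
          using True by (intro deg) (simp add: m_def)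
        then have "(S * W) $$ (i, k) = poly (monom 1 (n - Suc i) * p) (x l)"
          unfolding SW[OF ik] using True l
          by (subst poly_eq_sum_descending) (auto simp: S_top W_right intro!: sum.cong)
        also have "\<dots> = 0" using root l by (simp add: m_def)
        also have "\<dots> = R $$ (i, k)"
          using ik True l V_carrier by (auto simp: R_def U_def)
        finally show ?thesis .
      next
        case False
        then obtain t where t: "i = t + n" "t < m"
          using ik by (metis add.commute add_less_cancel_right le_Suc_ex linorder_not_less)
        have "degree (monom 1 (m - Suc t) * q) < m + n"
          using t by (intro deg) (simp add: n_def)
        then have "(S * W) $$ (i, k) = poly (monom 1 (m - Suc t) * q) (x l)"
          unfolding SW[OF ik] using l t
          by (subst poly_eq_sum_descending) (auto simp: S_bot W_right intro!: sum.cong)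
        also have "\<dots> = x l ^ (m - Suc t) * poly q (x l)" by (simp add: poly_monom)
        also have "\<dots> = R $$ (i, k)"
          using l t V_carrier
          by (auto simp: R_def U_def L_def mat_diag_mult_right[OF V_carrier]) (simp add: V_def)
        finally show ?thesis .
      qed
    qed
  qed
  have "Determinant.det W = Determinant.det V"
    unfolding W_def using V_carrier
    by (subst det_four_block_mat_lower_left_zero[of _ n _ m]) auto
  moreover have "Determinant.det U = lead_coeff p ^ n"
  proof -
    have "Determinant.det U = prod_list (diag_mat U)"
      by (rule det_upper_triangular[of _ n])
         (auto simp: U_def S_top coeff_monom_mult coeff_eq_0 m_def)
    also have "\<dots> = (\<Prod>i<n. lead_coeff p)"
      unfolding prod_list_diag_prod atLeast0LessThan
      by (intro prod.cong) (auto simp: U_def S_top coeff_monom_mult m_def)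
    finally show ?thesis by simp
  qed
  moreover have "Determinant.det R = Determinant.det U *
      (Determinant.det V * (\<Prod>k<m. poly q (x k)))"
  proof -
    have "Determinant.det R = Determinant.det U * Determinant.det (V * mat_diag m (\<lambda>k. poly q (x k)))"
      unfolding R_def using V_carrier
      by (intro det_four_block_mat_upper_right_zero[of _ n _ m]) (auto simp: U_def L_def)
    also have "Determinant.det (V * mat_diag m (\<lambda>k. poly q (x k))) =
        Determinant.det V * Determinant.det (mat_diag m (\<lambda>k. poly q (x k)))"
      using V_carrier by (intro det_mult) auto
    also have "Determinant.det (mat_diag m (\<lambda>k. poly q (x k))) = (\<Prod>k<m. poly q (x k))"
      by (subst det_upper_triangular[of _ m])
         (auto simp: prod_list_diag_prod atLeast0LessThan mat_diag_def intro!: prod.cong)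
    finally show ?thesis .
  qed
  moreover have "Determinant.det (S * W) = Determinant.det S * Determinant.det W"
    using S_carrier W_carrier by (rule det_mult)
  moreover have "Determinant.det V \<noteq> 0"
    unfolding V_def using inj by (intro det_vandermonde_nonzero) (simp add: m_def)
  ultimately have "Determinant.det S = lead_coeff p ^ n * (\<Prod>k<m. poly q (x k))"
    unfolding eq by (simp add: mult_ac)
  then show ?thesis
    by (simp add: resultant_def S_def m_def n_def)
qed
section \<open>Separation of the zeros of an integer polynomial\<close>

lemma complex_poly_eq_prod_simple_roots:
  fixes p :: "complex poly"
  assumes "\<And>z. poly p z = 0 \<Longrightarrow> order z p = 1"
  shows "p = Polynomial.smult (lead_coeff p) (\<Prod>z | poly p z = 0. [:-z, 1:])"
proof -
  have "(\<Prod>z | poly p z = 0. [:-z, 1:] ^ order z p) = (\<Prod>z | poly p z = 0. [:-z, 1:])"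
    using assms by (intro prod.cong) auto
  with complex_poly_decompose[of p] show ?thesis by simp
qed

lemma poly_pderiv_at_root_of_prod:
  fixes Z :: "'a::field_char_0 set"
  assumes "finite Z" "w \<in> Z"
  shows "poly (pderiv (Polynomial.smult a (\<Prod>z\<in>Z. [:-z, 1:]))) w = a * (\<Prod>z\<in>Z - {w}. w - z)"
proof -
  have "(\<Prod>z\<in>Z. [:-z, 1:]) = [:-w, 1:] * (\<Prod>z\<in>Z - {w}. [:-z, 1:])"
    using assms by (rule prod.remove)
  then have "poly (pderiv (\<Prod>z\<in>Z. [:-z, 1:])) w = (\<Prod>z\<in>Z - {w}. w - z)"
    by (simp only: pderiv_mult poly_add poly_mult) (simp add: pderiv_pCons poly_prod)
  then show ?thesis by (simp add: pderiv_smult)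
qed

text \<open>
  The resultant of \<open>P\<close> and its derivative is an integer, and \<open>resultant_eq_prod_over_roots\<close> shows
  that it is nonzero: at a simple root the derivative equals the leading coefficient times the product
  of the differences to the other roots. The exponent only grows linearly with the degree; a
  bound with exponent of order \<open>n\<^sup>2\<close>, as the Hankel determinant of the power sums would give, would
  be too weak to make the power sums small.
\<close>
lemma int_poly_root_separation:
  fixes P :: "int poly"
  defines "p \<equiv> map_poly of_int P :: complex poly"
  defines "Z \<equiv> {z. poly p z = 0}"
  assumes "degree P > 0"
    and simple: "\<And>z. poly p z = 0 \<Longrightarrow> order z p = 1"
  shows "card Z = degree P"
    and "1 \<le> real_of_int \<bar>lead_coeff P\<bar> ^ (2 * degree P - 1) *
           (\<Prod>w\<in>Z. \<Prod>z\<in>Z - {w}. cmod (w - z))"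
proof -
  define a where "a = lead_coeff p"
  have deg_p: "degree p = degree P" by (simp add: p_def)
  have a: "a = of_int (lead_coeff P)" by (simp add: a_def p_def)
  have "p \<noteq> 0" using deg_p \<open>degree P > 0\<close> by auto
  then have "finite Z" unfolding Z_def by (rule poly_roots_finite)
  have p_eq: "p = Polynomial.smult a (\<Prod>z\<in>Z. [:-z, 1:])"
    unfolding a_def Z_def using simple by (rule complex_poly_eq_prod_simple_roots)
  have "a \<noteq> 0" using \<open>p \<noteq> 0\<close> by (simp add: a_def)
  have "degree p = card Z"
    using \<open>a \<noteq> 0\<close> by (subst p_eq) (simp add: degree_prod_sum_eq)
  then show card_Z: "card Z = degree P" by (simp add: deg_p)
  then obtain x where x: "bij_betw x {..<degree p} Z"
    using ex_bij_betw_nat_finite[OF \<open>finite Z\<close>] by (auto simp: deg_p atLeast0LessThan)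
  have "of_int (resultant P (pderiv P)) = resultant p (map_poly of_int (pderiv P) :: complex poly)"
    unfolding p_def by (simp add: of_int_hom.resultant_hom)
  also have "map_poly of_int (pderiv P) = pderiv p"
    by (simp add: p_def of_int_hom.map_poly_pderiv)
  also have "resultant p (pderiv p) = a ^ degree (pderiv p) * (\<Prod>k<degree p. poly (pderiv p) (x k))"
    unfolding a_def using x
    by (intro resultant_eq_prod_over_roots) (auto simp: bij_betw_def Z_def)
  also have "(\<Prod>k<degree p. poly (pderiv p) (x k)) = (\<Prod>w\<in>Z. poly (pderiv p) w)"
    using x by (rule prod.reindex_bij_betw)
  also have "\<dots> = (\<Prod>w\<in>Z. a * (\<Prod>z\<in>Z - {w}. w - z))"
    by (subst p_eq, intro prod.cong refl poly_pderiv_at_root_of_prod \<open>finite Z\<close>)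
  also have "a ^ degree (pderiv p) * \<dots> =
      a ^ (2 * degree P - 1) * (\<Prod>w\<in>Z. \<Prod>z\<in>Z - {w}. w - z)"
    using \<open>degree P > 0\<close>
    by (simp add: prod.distrib card_Z degree_pderiv deg_p mult.assoc[symmetric] power_add[symmetric])
       (simp add: mult_2)
  finally have res: "of_int (resultant P (pderiv P)) =
      a ^ (2 * degree P - 1) * (\<Prod>w\<in>Z. \<Prod>z\<in>Z - {w}. w - z)" .
  have "of_int (resultant P (pderiv P)) \<noteq> (0::complex)"
    unfolding res using \<open>a \<noteq> 0\<close> \<open>finite Z\<close> by auto
  then have "1 \<le> \<bar>resultant P (pderiv P)\<bar>" by simp
  then have "1 \<le> real_of_int \<bar>resultant P (pderiv P)\<bar>" by linarith
  also have "\<dots> = cmod (of_int (resultant P (pderiv P)))" by (simp add: norm_of_int)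
  also have "\<dots> = real_of_int \<bar>lead_coeff P\<bar> ^ (2 * degree P - 1) *
           (\<Prod>w\<in>Z. \<Prod>z\<in>Z - {w}. cmod (w - z))"
    unfolding res by (simp add: a norm_mult norm_power prod_norm)
  finally show "1 \<le> \<dots>" .
qed

section \<open>Power sums and logarithmic energy\<close>

definition power_sum :: "'a::comm_semiring_1 set \<Rightarrow> nat \<Rightarrow> 'a" where
  "power_sum Z k = (\<Sum>z\<in>Z. z ^ k)"

text \<open>The term with \<open>k = 0\<close> is zero, as division by zero yields zero.\<close>
lemma neg_ln_norm_one_minus_sums:
  fixes w :: complex
  assumes "cmod w < 1"
  shows "(\<lambda>k. Re (w ^ k) / real k) sums (- ln (cmod (1 - w)))"
proof -
  have "(\<lambda>k. - (w ^ k / of_nat k)) sums Ln (1 - w)"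
    using Ln_series'[of "- w"] assms by simp
  from sums_Re[OF sums_minus[OF this]]
  have "(\<lambda>k. Re (w ^ k) / real k) sums - Re (Ln (1 - w))" by simp
  moreover have "1 - w \<noteq> 0" using assms by auto
  ultimately show ?thesis by simp
qed

text \<open>
  Expanding each logarithm and summing over all pairs turns \<open>\<Sum>\<^sub>z\<^sub>,\<^sub>w (z cnj w)\<^sup>k\<close> into
  \<open>|power_sum Z k|\<^sup>2\<close>. The factor \<open>r < 1\<close> makes the series converge even for points on the unit
  circle, where the diagonal terms would be infinite.
\<close>
lemma power_sum_energy:
  fixes Z :: "complex set"
  assumes "finite Z" "Z \<subseteq> cball 0 1" "0 < r" "r < 1"
  shows "(\<lambda>k. r ^ k / real k * (cmod (power_sum Z k))\<^sup>2) sums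
    (\<Sum>z\<in>Z. \<Sum>w\<in>Z. - ln (cmod (1 - of_real r * (z * cnj w))))"
proof -
  have "cmod (of_real r * (z * cnj w)) < 1" if "z \<in> Z" "w \<in> Z" for z w
  proof -
    have "cmod z \<le> 1" "cmod w \<le> 1" using assms(2) that by (auto simp: dist_norm)
    then have "cmod z * cmod w \<le> 1" by (intro mult_le_one) auto
    then have "r * (cmod z * cmod w) \<le> r * 1" using assms(3) by (intro mult_left_mono) auto
    then have "r * (cmod z * cmod w) < 1" using assms(4) by linarith
    then show ?thesis using assms(3) by (simp add: norm_mult)
  qed
  then have "(\<lambda>k. \<Sum>z\<in>Z. \<Sum>w\<in>Z. Re ((of_real r * (z * cnj w)) ^ k) / real k) sums
    (\<Sum>z\<in>Z. \<Sum>w\<in>Z. - ln (cmod (1 - of_real r * (z * cnj w))))"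
    by (intro sums_sum neg_ln_norm_one_minus_sums) auto
  moreover have "(\<Sum>z\<in>Z. \<Sum>w\<in>Z. Re ((of_real r * (z * cnj w)) ^ k) / real k) =
      r ^ k / real k * (cmod (power_sum Z k))\<^sup>2" for k
  proof -
    have "complex_of_real ((cmod (power_sum Z k))\<^sup>2) = power_sum Z k * cnj (power_sum Z k)"
      by (rule complex_norm_square)
    also have "\<dots> = (\<Sum>z\<in>Z. \<Sum>w\<in>Z. (z * cnj w) ^ k)"
      by (simp add: power_sum_def sum_product power_mult_distrib)
    finally have "(cmod (power_sum Z k))\<^sup>2 = Re (\<Sum>z\<in>Z. \<Sum>w\<in>Z. (z * cnj w) ^ k)"
      by (metis Re_complex_of_real)
    moreover have "Re ((of_real r * (z * cnj w)) ^ k) / real k = r ^ k / real k * Re ((z * cnj w) ^ k)"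
      for z w
    proof -
      have "(of_real r * (z * cnj w)) ^ k = of_real (r ^ k) * (z * cnj w) ^ k"
        by (simp only: power_mult_distrib of_real_power)
      then show ?thesis by simp
    qed
    ultimately show ?thesis
      by (simp only: Re_sum sum_distrib_left)
  qed
  ultimately show ?thesis by (simp only:)
qed

text \<open>
  In the open disk this says that the pseudo-hyperbolic distance of two points is at most \<open>1\<close>.
\<close>
lemma norm_diff_le_norm_one_minus_mult_cnj:
  fixes z w :: complex
  assumes "cmod z \<le> 1" "cmod w \<le> 1"
  shows "cmod (z - w) \<le> cmod (1 - z * cnj w)"
proof -
  have "(cmod (1 - z * cnj w))\<^sup>2 - (cmod (z - w))\<^sup>2 = (1 - (cmod z)\<^sup>2) * (1 - (cmod w)\<^sup>2)"
    unfolding cmod_power2 by (simp add: power2_eq_square algebra_simps)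
  moreover have "0 \<le> \<dots>"
    using assms by (intro mult_nonneg_nonneg) (auto simp: power_le_one)
  ultimately show ?thesis
    by (intro power2_le_imp_le[OF _ norm_ge_zero]) linarith
qed

text \<open>
  This is the price of the regularisation. The triangle inequality would only give the factor
  \<open>1/2\<close>, which over all pairs loses a multiple of \<open>n\<^sup>2\<close> in the energy; with the factor
  \<open>sqrt r\<close> and \<open>r = 1 - 1/n\<close> the loss is of order \<open>n\<close>.
\<close>
lemma sqrt_mult_norm_one_minus_le:
  fixes w :: complex
  assumes "0 \<le> r" "r \<le> 1" "cmod w \<le> 1"
  shows "sqrt r * cmod (1 - w) \<le> cmod (1 - of_real r * w)"
proof -
  have "(cmod (1 - of_real r * w))\<^sup>2 - (sqrt r * cmod (1 - w))\<^sup>2 = (1 - r) * (1 - r * (cmod w)\<^sup>2)"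
    using assms(1) unfolding power_mult_distrib cmod_power2
    by (simp add: power2_eq_square algebra_simps)
  moreover have "0 \<le> \<dots>"
    using assms by (intro mult_nonneg_nonneg) (auto simp: power_le_one mult_le_one)
  ultimately show ?thesis
    by (intro power2_le_imp_le[OF _ norm_ge_zero]) linarith
qed

text \<open>
  In \<open>power_sum_energy\<close> all terms of the series are nonnegative, so a single one is bounded by the
  double sum of logarithms. The diagonal of that sum is bounded by the distance \<open>1 - r\<close> from \<open>1\<close>
  to the disk of radius \<open>r\<close>, and the other terms by the separation of the points,
  which \<open>K\<close> measures.
\<close>
lemma norm_power_sum_square_le:
  fixes Z :: "complex set"
  assumes "finite Z" "Z \<subseteq> cball 0 1" and r: "0 < r" "r < 1"
    and sep: "1 \<le> K * (\<Prod>w\<in>Z. \<Prod>z\<in>Z - {w}. cmod (w - z))" and "0 < K" and "0 < m"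
  defines "n \<equiv> real (card Z)"
  shows "(cmod (power_sum Z m))\<^sup>2 \<le>
    real m / r ^ m * (n * ln (1 / (1 - r)) + n * (n - 1) / 2 * ln (1 / r) + ln K)"
proof -
  have disk: "cmod z \<le> 1" if "z \<in> Z" for z using assms(2) that by (auto simp: dist_norm)
  have diag: "- ln (cmod (1 - of_real r * (w * cnj w))) \<le> ln (1 / (1 - r))" if "w \<in> Z" for w
  proof -
    have "cmod (of_real r * (w * cnj w)) \<le> r * 1"
      unfolding norm_mult using disk[OF that] r by (intro mult_mono) (auto simp: mult_le_one)
    then have "1 - r \<le> cmod (1 - of_real r * (w * cnj w))"
      using norm_triangle_ineq2[of 1 "of_real r * (w * cnj w)"] by simp
    then have "ln (1 - r) \<le> ln (cmod (1 - of_real r * (w * cnj w)))"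
      using r by (intro ln_mono) auto
    then show ?thesis using r by (simp add: ln_div)
  qed
  have off: "- ln (cmod (1 - of_real r * (w * cnj z))) \<le> ln (1 / r) / 2 - ln (cmod (w - z))"
    if "w \<in> Z" "z \<in> Z - {w}" for w z
  proof -
    have "cmod (w * cnj z) \<le> 1"
      using disk that by (auto simp: norm_mult intro!: mult_le_one)
    then have "sqrt r * cmod (w - z) \<le> cmod (1 - of_real r * (w * cnj z))"
      using norm_diff_le_norm_one_minus_mult_cnj[of w z] sqrt_mult_norm_one_minus_le[of r "w * cnj z"]
        disk that r
      by (smt (verit, best) DiffD1 mult_left_mono real_sqrt_ge_zero)
    moreover have "w \<noteq> z" using that by blast
    then have "0 < sqrt r * cmod (w - z)" using r by simp
    ultimately have "ln (sqrt r * cmod (w - z)) \<le> ln (cmod (1 - of_real r * (w * cnj z)))"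
      by (intro ln_mono) auto
    moreover have "ln (sqrt r * cmod (w - z)) = - ln (1 / r) / 2 + ln (cmod (w - z))"
      using \<open>w \<noteq> z\<close> r by (simp add: ln_mult ln_sqrt ln_div)
    ultimately show ?thesis by linarith
  qed
  have pos: "0 < (\<Prod>z\<in>Z - {w}. cmod (w - z))" for w
    by (intro prod_pos) auto
  have "ln (\<Prod>w\<in>Z. \<Prod>z\<in>Z - {w}. cmod (w - z)) = (\<Sum>w\<in>Z. \<Sum>z\<in>Z - {w}. ln (cmod (w - z)))"
  proof -
    have "ln (\<Prod>w\<in>Z. \<Prod>z\<in>Z - {w}. cmod (w - z)) = (\<Sum>w\<in>Z. ln (\<Prod>z\<in>Z - {w}. cmod (w - z)))"
      by (rule ln_prod[OF \<open>finite Z\<close> less_imp_neq[OF pos, symmetric]])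
    also have "\<dots> = (\<Sum>w\<in>Z. \<Sum>z\<in>Z - {w}. ln (cmod (w - z)))"
      using \<open>finite Z\<close> by (intro sum.cong refl ln_prod) auto
    finally show ?thesis .
  qed
  moreover have "0 \<le> ln (K * (\<Prod>w\<in>Z. \<Prod>z\<in>Z - {w}. cmod (w - z)))"
    using sep by (rule ln_ge_zero)
  moreover have "0 < (\<Prod>w\<in>Z. \<Prod>z\<in>Z - {w}. cmod (w - z))"
    using pos by (intro prod_pos) auto
  ultimately have ln_sep: "- (\<Sum>w\<in>Z. \<Sum>z\<in>Z - {w}. ln (cmod (w - z))) \<le> ln K"
    using \<open>0 < K\<close> by (simp add: ln_mult)
  have energy: "(\<lambda>k. r ^ k / real k * (cmod (power_sum Z k))\<^sup>2) sums
    (\<Sum>w\<in>Z. \<Sum>z\<in>Z. - ln (cmod (1 - of_real r * (w * cnj z))))"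
    using assms(1,2) r by (rule power_sum_energy)
  have "r ^ m / real m * (cmod (power_sum Z m))\<^sup>2 =
      (\<Sum>k\<in>{m}. r ^ k / real k * (cmod (power_sum Z k))\<^sup>2)" by simp
  also have "\<dots> \<le> (\<Sum>k. r ^ k / real k * (cmod (power_sum Z k))\<^sup>2)"
    using sums_summable[OF energy] r by (intro sum_le_suminf) auto
  also have "\<dots> = (\<Sum>w\<in>Z. \<Sum>z\<in>Z. - ln (cmod (1 - of_real r * (w * cnj z))))"
    using energy by (rule sums_unique[symmetric])
  also have "\<dots> = (\<Sum>w\<in>Z. - ln (cmod (1 - of_real r * (w * cnj w))) +
      (\<Sum>z\<in>Z - {w}. - ln (cmod (1 - of_real r * (w * cnj z)))))"
    by (intro sum.cong refl sum.remove[OF \<open>finite Z\<close>])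
  also have "\<dots> \<le> (\<Sum>w\<in>Z. ln (1 / (1 - r)) + (\<Sum>z\<in>Z - {w}. ln (1 / r) / 2 - ln (cmod (w - z))))"
    by (intro sum_mono add_mono diag off)
  also have "\<dots> = n * ln (1 / (1 - r)) + n * ((n - 1) * (ln (1 / r) / 2)) +
      - (\<Sum>w\<in>Z. \<Sum>z\<in>Z - {w}. ln (cmod (w - z)))"
  proof -
    have "real (card (Z - {w})) = n - 1" if "w \<in> Z" for w
      using that \<open>finite Z\<close> card_Suc_Diff1[OF \<open>finite Z\<close> that] by (simp add: n_def)
    then show ?thesis
      by (simp add: sum.distrib sum_subtractf n_def)
  qed
  also have "\<dots> \<le> n * ln (1 / (1 - r)) + n * (n - 1) / 2 * ln (1 / r) + ln K"
    using ln_sep by simp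
  finally show ?thesis
    using r \<open>0 < m\<close> by (simp add: field_simps)
qed

lemma n_ln_n_ge_1:
  assumes "2 \<le> n"
  shows "1 \<le> real n * ln (real n)"
proof -
  have "1 \<le> 2 * ln (2::real)" using ln2_ge_two_thirds by simp
  also have "\<dots> \<le> real n * ln (real n)"
    using assms by (intro mult_mono ln_mono) auto
  finally show ?thesis .
qed

text \<open>
  In the constant, \<open>2\<^sup>m\<close> bounds \<open>r\<^sup>-\<^sup>m\<close> for the radius \<open>r = 1 - 1/n \<ge> 1/2\<close>, the summand \<open>2\<close>
  covers the diagonal and the regularisation, and \<open>3 ln A\<close> the leading coefficient, as
  \<open>2 n \<le> 3 n ln n\<close>.
\<close>
lemma norm_power_sum_le:
  fixes Z :: "complex set"
  assumes "finite Z" "Z \<subseteq> cball 0 1" and "n = card Z" "2 \<le> n"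
    and "1 \<le> A" and sep: "1 \<le> A ^ (2 * n - 1) * (\<Prod>w\<in>Z. \<Prod>z\<in>Z - {w}. cmod (w - z))"
    and "0 < m"
  shows "cmod (power_sum Z m) \<le> 
    sqrt (2 ^ m * real m * (2 + 3 * ln A)) * sqrt (real n * ln (real n))"
proof -
  \<comment> \<open>With this choice the diagonal term is exactly \<open>n ln n\<close>, and the cost of the regularisation is
    at most \<open>n / 2\<close>.\<close>
  define r where "r = 1 - 1 / real n"
  define s where "s = real n * ln (real n)"
  have r: "0 < r" "r < 1" "1 / 2 \<le> r" using \<open>2 \<le> n\<close> by (auto simp: r_def field_simps)
  have "1 \<le> s" unfolding s_def using \<open>2 \<le> n\<close> by (rule n_ln_n_ge_1)
  have "2 / 3 \<le> ln (real n)"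
    using ln2_ge_two_thirds ln_mono[of 2 "real n"] \<open>2 \<le> n\<close> by linarith
  then have n_le: "real n \<le> 3 / 2 * s"
    unfolding s_def using mult_left_mono[of "2 / 3" "ln (real n)" "real n"] by simp
  have "ln (1 / r) \<le> 1 / r - 1" using r by (intro ln_le_minus_one) auto
  also have "\<dots> = 1 / (real n - 1)" using \<open>2 \<le> n\<close> by (simp add: r_def field_simps)
  finally have "real n * (real n - 1) / 2 * ln (1 / r) \<le> real n * (real n - 1) / 2 * (1 / (real n - 1))"
    using \<open>2 \<le> n\<close> by (intro mult_left_mono) auto
  also have "\<dots> = real n / 2" using \<open>2 \<le> n\<close> by (simp add: divide_simps)
  also have "\<dots> \<le> s" using n_le \<open>1 \<le> s\<close> by simp
  finally have off: "real n * (real n - 1) / 2 * ln (1 / r) \<le> s" .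
  have diag: "real n * ln (1 / (1 - r)) = s" by (simp add: r_def s_def)
  have "ln (A ^ (2 * n - 1)) \<le> 2 * real n * ln A"
    using \<open>1 \<le> A\<close> \<open>2 \<le> n\<close> by (simp add: ln_realpow of_nat_diff algebra_simps)
  also have "\<dots> \<le> 3 * ln A * s"
    using mult_right_mono[OF n_le, of "2 * ln A"] \<open>1 \<le> A\<close> by (simp add: mult_ac)
  finally have lead: "ln (A ^ (2 * n - 1)) \<le> 3 * ln A * s" .
  have "(cmod (power_sum Z m))\<^sup>2 \<le> real m / r ^ m *
      (real n * ln (1 / (1 - r)) + real n * (real n - 1) / 2 * ln (1 / r) + ln (A ^ (2 * n - 1)))"
    unfolding \<open>n = card Z\<close> using assms r
    by (intro norm_power_sum_square_le) auto
  also have "\<dots> \<le> real m / r ^ m * (s + s + 3 * ln A * s)"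
    unfolding diag using off lead r by (intro mult_left_mono add_mono) auto
  also have "s + s + 3 * ln A * s = (2 + 3 * ln A) * s"
    by (simp add: algebra_simps)
  also have "real m / r ^ m * ((2 + 3 * ln A) * s) \<le> real m / (1 / 2) ^ m * ((2 + 3 * ln A) * s)"
    using r \<open>1 \<le> s\<close> \<open>1 \<le> A\<close>
    by (intro mult_right_mono divide_left_mono power_mono mult_pos_pos) auto
  also have "\<dots> = 2 ^ m * real m * (2 + 3 * ln A) * s"
    by (simp add: power_divide)
  finally have "cmod (power_sum Z m) \<le> sqrt (2 ^ m * real m * (2 + 3 * ln A) * s)"
    by (rule real_le_rsqrt)
  then show ?thesis by (simp add: real_sqrt_mult s_def)
qed

section \<open>From power sums to coefficients\<close>

text \<open>
  Newton's identities say that the logarithmic derivative of \<open>\<Prod> (1 - z X)\<close> is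
  \<open>- \<Sum> z / (1 - z X)\<close>, whose coefficients are the negated power sums. In this form they follow
  from the product rule by adding one point at a time.
\<close>
lemma newton_identity_fps:
  fixes Z :: "'a::field_char_0 set"
  assumes "finite Z"
  shows "fps_deriv (\<Prod>z\<in>Z. 1 - fps_const z * fps_X) =
    - (\<Prod>z\<in>Z. 1 - fps_const z * fps_X) * Abs_fps (\<lambda>k. power_sum Z (Suc k))"
  using assms
proof (induction rule: finite_induct)
  case empty
  then show ?case by (simp add: power_sum_def fps_eq_iff)
next
  case (insert w Z)
  define E where "E = (\<Prod>z\<in>Z. 1 - fps_const z * fps_X)"
  define G where "G = Abs_fps (\<lambda>k. w ^ Suc k)"
  have G: "(1 - fps_const w * fps_X) * G = fps_const w"
  proof (rule fps_ext)
    fix k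
    show "fps_nth ((1 - fps_const w * fps_X) * G) k = fps_nth (fps_const w) k"
      by (cases k) (simp_all add: G_def algebra_simps)
  qed
  have S: "Abs_fps (\<lambda>k. power_sum (insert w Z) (Suc k)) =
      G + Abs_fps (\<lambda>k. power_sum Z (Suc k))"
    using insert.hyps by (simp add: fps_eq_iff power_sum_def G_def)
  define A where "A = Abs_fps (\<lambda>k. power_sum Z (Suc k))"
  define F where "F = 1 - fps_const w * fps_X"
  have "fps_deriv E = - E * A"
    using insert.IH by (simp only: E_def A_def)
  moreover have "fps_deriv F = - (F * G)"
    unfolding F_def G by simp
  ultimately have "fps_deriv (F * E) = - (F * E) * (G + A)"
    by (simp add: algebra_simps)
  then show ?case
    using insert.hyps by (simp only: S prod.insert E_def F_def A_def not_False_eq_True)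
qed

lemma newton_identity:
  fixes Z :: "'a::field_char_0 set"
  assumes "finite Z" and p: "p = Polynomial.smult a (\<Prod>z\<in>Z. [:-z, 1:])" and "0 < m" "m \<le> card Z"
  shows "of_nat m * coeff p (card Z - m) =
    - (\<Sum>i<m. coeff p (card Z - i) * power_sum Z (m - i))"
proof -
  \<comment> \<open>\<open>E\<close> is \<open>p\<close> with its coefficients reversed, which is why the coefficients of \<open>p\<close> are counted
    from the top.\<close>
  define E where "E = fps_const a * (\<Prod>z\<in>Z. 1 - fps_const z * fps_X)"
  have "reflect_poly [:-z, 1:] = [:1, -z:]" for z :: 'a
    by (simp add: reflect_poly_def)
  then have "reflect_poly p = Polynomial.smult a (\<Prod>z\<in>Z. [:1, -z:])"
    unfolding p by (simp add: reflect_poly_smult reflect_poly_prod)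
  moreover have "fps_of_poly (Polynomial.smult a (\<Prod>z\<in>Z. [:1, -z:])) = E"
    by (simp add: E_def fps_of_poly_smult fps_of_poly_prod fps_of_poly_linear' flip: fps_const_neg)
  ultimately have nth: "fps_nth E i = coeff (reflect_poly p) i" for i
    by (metis fps_of_poly_nth)
  show ?thesis
  proof (cases "a = 0")
    case True
    then show ?thesis by (simp add: p)
  next
    case False
    then have "degree p = card Z" by (simp add: p degree_prod_sum_eq)
    then have nth_eq: "fps_nth E i = coeff p (card Z - i)" if "i \<le> card Z" for i
      using that by (simp add: nth coeff_reflect_poly)
    have deriv: "fps_deriv E = - E * Abs_fps (\<lambda>k. power_sum Z (Suc k))"
      using newton_identity_fps[OF \<open>finite Z\<close>] by (simp add: E_def mult.assoc)
    have "of_nat m * coeff p (card Z - m) = fps_nth (fps_deriv E) (m - 1)"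
      using \<open>0 < m\<close> \<open>m \<le> card Z\<close> by (simp add: nth_eq)
    also have "\<dots> = - (\<Sum>i\<le>m - 1. fps_nth E i * power_sum Z (Suc (m - 1 - i)))"
      unfolding deriv by (simp add: fps_mult_nth atLeast0AtMost sum_negf)
    also have "(\<Sum>i\<le>m - 1. fps_nth E i * power_sum Z (Suc (m - 1 - i))) =
        (\<Sum>i<m. coeff p (card Z - i) * power_sum Z (m - i))"
      using \<open>0 < m\<close> \<open>m \<le> card Z\<close>
      by (intro sum.cong) (auto simp: nth_eq Suc_diff_le[symmetric])
    finally show ?thesis .
  qed
qed
text \<open>
  Here \<open>e\<close> stands for the coefficients counted from the top and \<open>p\<close> for the power sums. The
  hypothesis \<open>1 \<le> s\<close> allows to replace \<open>s\<close> by \<open>s\<^sup>k\<close> in the bound for \<open>p k\<close>; then the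
  recursion is homogeneous in \<open>s\<close>, and the constants \<open>(1 + c)\<^sup>j\<close> reproduce themselves because
  \<open>c \<Sum>\<^sub>i\<^sub><\<^sub>j (1 + c)\<^sup>i = (1 + c)\<^sup>j - 1\<close>.
\<close>
lemma norm_coeff_le_of_power_sum_le:
  fixes e :: "nat \<Rightarrow> 'a::real_normed_field" and c s A :: real
  assumes newton: "\<And>j. 0 < j \<Longrightarrow> j \<le> m \<Longrightarrow> of_nat j * e j = - (\<Sum>i<j. e i * p (j - i))"
    and p: "\<And>k. 0 < k \<Longrightarrow> k \<le> m \<Longrightarrow> norm (p k) \<le> c * s"
    and "norm (e 0) \<le> A" "1 \<le> s" "0 \<le> c"
  shows "norm (e m) \<le> A * (1 + c) ^ m * s ^ m"
proof -
  have "0 \<le> A" using norm_ge_zero assms(3) by (rule order.trans)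
  have "j \<le> m \<Longrightarrow> norm (e j) \<le> A * (1 + c) ^ j * s ^ j" for j
  proof (induction j rule: less_induct)
    case (less j)
    show ?case
    proof (cases "j = 0")
      case True
      then show ?thesis using assms(3) by simp
    next
      case False
      have "norm (e i * p (j - i)) \<le> A * s ^ j * (c * (1 + c) ^ i)" if "i < j" for i
      proof -
        have "norm (e i * p (j - i)) \<le> (A * (1 + c) ^ i * s ^ i) * (c * s)"
          unfolding norm_mult using that less.prems
          by (intro mult_mono less.IH p norm_ge_zero)
             (use \<open>0 \<le> A\<close> \<open>0 \<le> c\<close> \<open>1 \<le> s\<close> in auto)
        also have "\<dots> = A * (c * (1 + c) ^ i) * s ^ Suc i" by simp
        also have "\<dots> \<le> A * (c * (1 + c) ^ i) * s ^ j"
          using that \<open>0 \<le> A\<close> \<open>0 \<le> c\<close> \<open>1 \<le> s\<close>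
          by (intro mult_left_mono power_increasing mult_nonneg_nonneg) auto
        finally show ?thesis by (simp add: mult_ac)
      qed
      then have "norm (\<Sum>i<j. e i * p (j - i)) \<le> (\<Sum>i<j. A * s ^ j * (c * (1 + c) ^ i))"
        by (intro sum_norm_le) auto
      also have "\<dots> = A * s ^ j * ((1 + c) ^ j - 1)"
        using power_diff_1_eq[of "1 + c" j] by (simp add: sum_distrib_left)
      also have "\<dots> \<le> A * s ^ j * (1 + c) ^ j"
        using \<open>0 \<le> A\<close> \<open>1 \<le> s\<close> by (intro mult_left_mono) auto
      finally have "real j * norm (e j) \<le> A * (1 + c) ^ j * s ^ j"
        using arg_cong[OF newton[of j], of norm] False less.prems
        by (simp add: norm_mult mult_ac)
      moreover have "1 * norm (e j) \<le> real j * norm (e j)"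
        using False by (intro mult_right_mono) auto
      ultimately show ?thesis by linarith
    qed
  qed
  then show ?thesis by blast
qed
section \<open>The coefficient bound\<close>

theorem theorem2p7:
  shows "\<forall>M::real. \<forall>m::nat. M > 0 \<longrightarrow> m \<ge> 1 \<longrightarrow>
    (\<exists>C::real. C > 0 \<and>
      (\<forall>n::nat. n \<ge> 2 \<longrightarrow> n \<ge> m \<longrightarrow>
        (\<forall>P \<in> int_polys_simple_zeros n (cball 0 1) M.
          \<bar>real_of_int (coeff P (n - m))\<bar> \<le> C * (real n * ln (real n)) powr (real m / 2))))"
proof (intro allI impI)
  fix M :: real and m :: nat
  assume "M > 0" "m \<ge> 1"
  \<comment> \<open>For \<open>M < 1\<close> there are no such polynomials; the maximum keeps \<open>ln A\<close> nonnegative.\<close>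
  define A where "A = max 1 M"
  define B where "B = 2 + 3 * ln A"
  define c where "c = sqrt (2 ^ m * real m * B)"
  have "1 \<le> A" by (simp add: A_def)
  then have "0 \<le> B" by (simp add: B_def)
  then have "0 \<le> c" by (simp add: c_def)
  have bound: "\<bar>real_of_int (coeff P (n - m))\<bar> \<le>
      A * (1 + c) ^ m * (real n * ln (real n)) powr (real m / 2)"
    if n: "n \<ge> 2" "n \<ge> m" and P: "P \<in> int_polys_simple_zeros n (cball 0 1) M" for n P
  proof -
    define p where "p = (map_poly of_int P :: complex poly)"
    define Z where "Z = {z. poly p z = 0}"
    define s where "s = sqrt (real n * ln (real n))"
    have deg_P: "degree P = n" and lc: "\<bar>real_of_int (lead_coeff P)\<bar> \<le> M"
      and simple: "\<And>z. poly p z = 0 \<Longrightarrow> order z p = 1" and disk: "Z \<subseteq> cball 0 1"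
      using P by (auto simp: int_polys_simple_zeros_def p_def Z_def)
    have "degree P > 0" using deg_P n by simp
    have card_Z: "card Z = n"
      using int_poly_root_separation(1)[OF \<open>degree P > 0\<close>] simple deg_P
      by (simp add: Z_def p_def)
    then have "finite Z" using n card.infinite by fastforce
    have "1 \<le> real_of_int \<bar>lead_coeff P\<bar> ^ (2 * n - 1) * (\<Prod>w\<in>Z. \<Prod>z\<in>Z - {w}. cmod (w - z))"
      using int_poly_root_separation(2)[OF \<open>degree P > 0\<close>] simple
      unfolding deg_P Z_def p_def by blast
    also have "\<dots> \<le> A ^ (2 * n - 1) * (\<Prod>w\<in>Z. \<Prod>z\<in>Z - {w}. cmod (w - z))"
      using lc by (intro mult_right_mono power_mono prod_nonneg) (auto simp: A_def intro: prod_nonneg)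
    finally have sep: "1 \<le> A ^ (2 * n - 1) * (\<Prod>w\<in>Z. \<Prod>z\<in>Z - {w}. cmod (w - z))" .
    have nln: "1 \<le> real n * ln (real n)" using n by (intro n_ln_n_ge_1)
    then have "1 \<le> s" by (simp add: s_def)
    have ps: "cmod (power_sum Z k) \<le> c * s" if "0 < k" "k \<le> m" for k
    proof -
      have "cmod (power_sum Z k) \<le> sqrt (2 ^ k * real k * B) * s"
        unfolding s_def B_def using card_Z n
        by (intro norm_power_sum_le[OF \<open>finite Z\<close> disk _ _ \<open>1 \<le> A\<close> sep \<open>0 < k\<close>]) auto
      also have "\<dots> \<le> c * s"
        unfolding c_def using that \<open>0 \<le> B\<close> \<open>1 \<le> s\<close>
        by (intro mult_right_mono real_sqrt_le_mono mult_mono power_increasing) auto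
      finally show ?thesis .
    qed
    have p_eq: "p = Polynomial.smult (lead_coeff p) (\<Prod>z\<in>Z. [:-z, 1:])"
      unfolding Z_def using simple by (rule complex_poly_eq_prod_simple_roots)
    have coeff_p: "cmod (coeff p i) = \<bar>real_of_int (coeff P i)\<bar>" for i
      by (simp add: p_def)
    have "cmod (coeff p (n - m)) \<le> A * (1 + c) ^ m * s ^ m"
    proof (rule norm_coeff_le_of_power_sum_le[of m "\<lambda>i. coeff p (n - i)" "power_sum Z"])
      show "of_nat j * coeff p (n - j) = - (\<Sum>i<j. coeff p (n - i) * power_sum Z (j - i))"
        if "0 < j" "j \<le> m" for j
        using newton_identity[OF \<open>finite Z\<close> p_eq, of j] that n by (simp add: card_Z)
      show "cmod (coeff p (n - 0)) \<le> A"
        using lc deg_P by (simp add: coeff_p A_def)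
    qed (use ps \<open>1 \<le> s\<close> \<open>0 \<le> c\<close> in auto)
    also have "s ^ m = (real n * ln (real n)) powr (real m / 2)"
    proof -
      have "s = (real n * ln (real n)) powr (1 / 2)"
        unfolding s_def using nln by (subst powr_half_sqrt) auto
      moreover have "s ^ m = s powr real m"
        using \<open>1 \<le> s\<close> by (subst powr_realpow) auto
      ultimately show ?thesis by (simp add: powr_powr)
    qed
    finally show ?thesis by (simp add: coeff_p)
  qed
  have "A * (1 + c) ^ m > 0" using \<open>1 \<le> A\<close> \<open>0 \<le> c\<close> by simp
  with bound show "\<exists>C::real. C > 0 \<and>
      (\<forall>n::nat. n \<ge> 2 \<longrightarrow> n \<ge> m \<longrightarrow>
        (\<forall>P \<in> int_polys_simple_zeros n (cball 0 1) M.
          \<bar>real_of_int (coeff P (n - m))\<bar> \<le> C * (real n * ln (real n)) powr (real m / 2)))"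
    by (intro exI[of _ "A * (1 + c) ^ m"]) auto
qed

end
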